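(* If $G$ is a graph of order $n$, then $\alpha'(G) + \frac{1}{2}\mathrm{pc}(G) \ge \frac{n}{2}$. Further, for $n \ge 3$, $\alpha'(G) + \frac{1}{2}\mathrm{pc}(G) = \frac{n}{2}$ if and only if $G$ has a spanning tree $T$ such that all of the following hold: (a) $(T,S) \in \mathcal{T}$ for some labeling $S$; (b) $\alpha'(G) = \alpha'(T)$; (c) $\mathrm{pc}(G) = \mathrm{pc}(T)$.
   Context: All graphs are finite and simple. The order of a graph is its number of vertices. The matching number $\alpha'(G)$ of a graph $G$ is the maximum number of edges in a matching (set of pairwise non-adjacent edges) of $G$. A path cover of $G$ is a collection of vertex-disjoint paths (subgraphs of $G$, single vertices allowed) such that every vertex of $G$ belongs to exactly one of the paths; the path covering number $\mathrm{pc}(G)$ is the minimum cardinality of a path cover of $G$. A labeling of a tree $T$ is a weak partition $S = (S_A, S_B, S_C)$ of $V(T)$ (a partition in which some parts may be empty); the pair $(T,S)$ is a labeled tree. The status $\mathrm{sta}(v)$ of a vertex $v$ is the letter $x \in \{A,B,C\}$ with $v \in S_x$. The family $\mathcal{T}$ is the smallest family of labeled trees that (i) contains $(P_3, S_0^* )$, where $P_3$ is the path on three vertices and $S_0^*$ assigns status $A$ to the central vertex and status $B$ to the two leaves; and (ii) is closed under the following four operations, each of which extends a labeled tree $T'$ by attaching a tree to a vertex $v \in V(T')$ (all statuses not mentioned are left unchanged): Operation $\mathcal{O}_1$: let $v$ be a vertex with $\mathrm{sta}(v)=A$. Add a new vertex $u_1$ and the edge $vu_1$; set $\mathrm{sta}(u_1)=B$.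 Operation $\mathcal{O}_2$: let $v$ be a vertex with $\mathrm{sta}(v)=B$. Add a new path $u_1u_2$ and the edge $vu_1$; change the status of $v$ from $B$ to $C$, and set $\mathrm{sta}(u_1)=A$, $\mathrm{sta}(u_2)=B$. Operation $\mathcal{O}_3$: let $v$ be an arbitrary vertex of $T'$. Add a new path $u_1u_2u_3$ and the edge $vu_2$; set $\mathrm{sta}(u_1)=\mathrm{sta}(u_3)=B$ and $\mathrm{sta}(u_2)=A$. Further, if $\mathrm{sta}(v)=B$, change the status of $v$ from $B$ to $C$. Operation $\mathcal{O}_4$: let $v$ be a vertex with $\mathrm{sta}(v)=A$. Add a new path $u_1u_2u_3u_4u_5$ and the edge $vu_3$; set $\mathrm{sta}(u_1)=\mathrm{sta}(u_5)=B$, $\mathrm{sta}(u_2)=\mathrm{sta}(u_4)=A$, and $\mathrm{sta}(u_3)=C$.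
   Formalization: The equivalence is stated only for connected G, since as written it fails for disconnected graphs (three isolated vertices attain equality but have no spanning tree); the inequality is for all G. *)

theory Defs
  imports Complex_Main
begin

type_synonym 'a ugraph = "'a set \<times> 'a set set"

abbreviation verts :: "'a ugraph \<Rightarrow> 'a set" where
  "verts G \<equiv> fst G"

abbreviation edges :: "'a ugraph \<Rightarrow> 'a set set" where
  "edges G \<equiv> snd G"

definition simple_graph :: "'a ugraph \<Rightarrow> bool" where
  "simple_graph G \<longleftrightarrow> finite (verts G) \<and> (\<forall>e\<in>edges G. e \<subseteq> verts G \<and> card e = 2)"

definition order :: "'a ugraph \<Rightarrow> nat" where
  "order G = card (verts G)"

definition subgraph :: "'a ugraph \<Rightarrow> 'a ugraph \<Rightarrow> bool" where
  "subgraph H G \<longleftrightarrow> simple_graph H \<and> verts H \<subseteq> verts G \<and> edges H \<subseteq> edges G"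

definition path_graph :: "'a list \<Rightarrow> 'a ugraph" where
  "path_graph xs = (set xs, {{xs ! i, xs ! Suc i} |i. Suc i < length xs})"

definition cycle_graph :: "'a list \<Rightarrow> 'a ugraph" where
  "cycle_graph xs = (set xs, insert {last xs, hd xs} (edges (path_graph xs)))"

definition is_path :: "'a ugraph \<Rightarrow> bool" where
  "is_path P \<longleftrightarrow> (\<exists>xs. xs \<noteq> [] \<and> distinct xs \<and> P = path_graph xs)"

definition is_cycle :: "'a ugraph \<Rightarrow> bool" where
  "is_cycle C \<longleftrightarrow> (\<exists>xs. length xs \<ge> 3 \<and> distinct xs \<and> C = cycle_graph xs)"

definition connected_graph :: "'a ugraph \<Rightarrow> bool" where
  "connected_graph G \<longleftrightarrow> verts G \<noteq> {} \<and>
     (\<forall>u\<in>verts G. \<forall>v\<in>verts G. \<exists>xs. xs \<noteq> [] \<and> distinct xs \<and> hd xs = u \<and> last xs = v \<and>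
        subgraph (path_graph xs) G)"

definition tree :: "'a ugraph \<Rightarrow> bool" where
  "tree T \<longleftrightarrow> simple_graph T \<and> connected_graph T \<and> (\<nexists>C. is_cycle C \<and> subgraph C T)"

definition spanning_tree :: "'a ugraph \<Rightarrow> 'a ugraph \<Rightarrow> bool" where
  "spanning_tree T G \<longleftrightarrow> tree T \<and> subgraph T G \<and> verts T = verts G"

definition matching :: "'a ugraph \<Rightarrow> 'a set set \<Rightarrow> bool" where
  "matching G M \<longleftrightarrow> M \<subseteq> edges G \<and> pairwise disjnt M"

definition matching_number :: "'a ugraph \<Rightarrow> nat" where
  "matching_number G = Max (card ` {M. matching G M})"

text \<open>Vertex-disjointness of the members of a path cover is part of the uniqueness below.\<close>

definition path_cover :: "'a ugraph \<Rightarrow> 'a ugraph set \<Rightarrow> bool" where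
  "path_cover G \<P> \<longleftrightarrow>
     (\<forall>P\<in>\<P>. is_path P \<and> subgraph P G) \<and> (\<forall>v\<in>verts G. \<exists>!P. P \<in> \<P> \<and> v \<in> verts P)"

definition path_covering_number :: "'a ugraph \<Rightarrow> nat" where
  "path_covering_number G = Min (card ` {\<P>. path_cover G \<P>})"

text \<open>A labeling is the triple \<open>(S\<^sub>A, S\<^sub>B, S\<^sub>C)\<close> of its status classes.\<close>

type_synonym 'a labeling = "'a set \<times> 'a set \<times> 'a set"

fun labeling_of :: "'a ugraph \<Rightarrow> 'a labeling \<Rightarrow> bool" where
  "labeling_of T (SA, SB, SC) \<longleftrightarrow>
     SA \<union> SB \<union> SC = verts T \<and> SA \<inter> SB = {} \<and> SA \<inter> SC = {} \<and> SB \<inter> SC = {}"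

text \<open>
  The vertex names of the starting path and of the attached trees are arbitrary (distinct and
  fresh), so the family is closed under isomorphism of labeled trees.
\<close>

inductive_set labeled_family :: "('a ugraph \<times> 'a labeling) set" where
  P3: "distinct [u, v, w] \<Longrightarrow> (path_graph [u, v, w], ({v}, {u, w}, {})) \<in> labeled_family"
| O1: "\<lbrakk>((V, E), (SA, SB, SC)) \<in> labeled_family; v \<in> SA; u1 \<notin> V\<rbrakk> \<Longrightarrow>
    ((V \<union> {u1}, E \<union> {{v, u1}}), (SA, SB \<union> {u1}, SC)) \<in> labeled_family"
| O2: "\<lbrakk>((V, E), (SA, SB, SC)) \<in> labeled_family; v \<in> SB;
      distinct [u1, u2]; {u1, u2} \<inter> V = {}\<rbrakk> \<Longrightarrow>
    ((V \<union> {u1, u2}, E \<union> {{v, u1}, {u1, u2}}),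
     (SA \<union> {u1}, (SB - {v}) \<union> {u2}, SC \<union> {v})) \<in> labeled_family"
| O3: "\<lbrakk>((V, E), (SA, SB, SC)) \<in> labeled_family; v \<in> V;
      distinct [u1, u2, u3]; {u1, u2, u3} \<inter> V = {}\<rbrakk> \<Longrightarrow>
    ((V \<union> {u1, u2, u3}, E \<union> {{v, u2}, {u1, u2}, {u2, u3}}),
     (SA \<union> {u2}, (SB - {v}) \<union> {u1, u3}, if v \<in> SB then SC \<union> {v} else SC))
       \<in> labeled_family"
| O4: "\<lbrakk>((V, E), (SA, SB, SC)) \<in> labeled_family; v \<in> SA;
      distinct [u1, u2, u3, u4, u5]; {u1, u2, u3, u4, u5} \<inter> V = {}\<rbrakk> \<Longrightarrow>
    ((V \<union> {u1, u2, u3, u4, u5}, E \<union> {{v, u3}, {u1, u2}, {u2, u3}, {u3, u4}, {u4, u5}}),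
     (SA \<union> {u2, u4}, SB \<union> {u1, u5}, SC \<union> {u3})) \<in> labeled_family"

end

theory Submission
  imports Defs
begin

text \<open>
  A path of order \<open>k\<close> has a matching with \<open>\<lfloor>k/2\<rfloor>\<close> edges, which misses at most one vertex.
  Doing this in every path of a minimum path cover gives a matching of \<open>G\<close> that misses at most
  \<open>pc(G)\<close> vertices, whence \<open>2\<alpha>'(G) + pc(G) \<ge> n\<close> (\<open>order_le_matching_path_covering_number\<close>).

  In a labeled tree \<open>(T, S)\<close> of the family, \<open>S\<^sub>A\<close> is a vertex cover, so
  \<open>\<alpha>'(T) \<le> |S\<^sub>A|\<close>. The operations also build up a path cover of \<open>T\<close> with at most \<open>n - 2|S\<^sub>A|\<close> paths
  (\<open>labeled_family_path_cover\<close>). Hence \<open>2\<alpha>'(T) + pc(T) \<le> n\<close>. If a spanning tree of \<open>G\<close> belongs to the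
  family and has the parameters of \<open>G\<close>, equality therefore carries over to \<open>G\<close>.

  Conversely, suppose \<open>G\<close> is connected, \<open>n \<ge> 3\<close> and \<open>2\<alpha>'(G) + pc(G) = n\<close>, and fix a
  minimum path cover. Since the matching above is then a maximum matching missing exactly one vertex
  of each path, all the paths have odd order. Number the vertices along each path from 1. An odd path
  minus a vertex at an odd position has a perfect matching, so an edge of \<open>G\<close> between odd positions of
  two paths would yield a larger matching: every edge between different paths meets an even position
  (\<open>equality_path_cover_structure\<close>). This is precisely the condition under which the operations can
  attach one of the paths to a labeled tree whose \<open>A\<close>-vertices are the even positions
  (\<open>labeled_family_attach_path\<close>). Some path has at least three vertices; starting from it and following
  edges of the connected graph \<open>G\<close>, one attaches all paths of the cover and obtains a spanning tree
  \<open>T\<close> of \<open>G\<close> in the family (\<open>equality_spanning_tree\<close>). As \<open>T\<close> contains the cover, \<open>pc(T) = pc(G)\<close>; as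
  both graphs attain equality, \<open>\<alpha>'(T) = \<alpha>'(G)\<close>.
\<close>

section \<open>Paths as lists\<close>

fun path_edges :: "'a list \<Rightarrow> 'a set set" where
  "path_edges (x # y # zs) = insert {x, y} (path_edges (y # zs))"
| "path_edges _ = {}"

lemma path_graph_eq: "path_graph xs = (set xs, path_edges xs)"
proof -
  have "{{xs ! i, xs ! Suc i} |i. Suc i < length xs} = path_edges xs"
  proof (induction xs rule: path_edges.induct)
    case (1 x y zs)
    have "{{(x # y # zs) ! i, (x # y # zs) ! Suc i} |i. Suc i < length (x # y # zs)} =
      insert {x, y} {{(y # zs) ! i, (y # zs) ! Suc i} |i. Suc i < length (y # zs)}" (is "?L = ?R")
    proof
      show "?L \<subseteq> ?R"
      proof
        fix e assume "e \<in> ?L"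
        then obtain i where "e = {(x # y # zs) ! i, (x # y # zs) ! Suc i}"
          "Suc i < length (x # y # zs)" by blast
        then show "e \<in> ?R" by (cases i) auto
      qed
      show "?R \<subseteq> ?L"
      proof
        fix e assume "e \<in> ?R"
        then consider "e = {x, y}" |
          i where "e = {(y # zs) ! i, (y # zs) ! Suc i}" "Suc i < length (y # zs)" by blast
        then show "e \<in> ?L"
        proof cases
          case 1 then show ?thesis by (intro CollectI exI[of _ 0]) auto
        next
          case 2 then show ?thesis by (intro CollectI exI[of _ "Suc i"]) auto
        qed
      qed
    qed
    with 1 show ?case by simp
  qed auto
  then show ?thesis by (simp add: path_graph_def)
qed

lemma path_edges_append:
  "path_edges (xs @ y # ys) = path_edges (xs @ [y]) \<union> path_edges (y # ys)"
  by (induction xs rule: path_edges.induct) auto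

lemma path_edges_Cons: "ys \<noteq> [] \<Longrightarrow> path_edges (x # ys) = insert {x, hd ys} (path_edges ys)"
  by (cases ys) auto

lemma path_edges_snoc: "xs \<noteq> [] \<Longrightarrow> path_edges (xs @ [y]) = insert {last xs, y} (path_edges xs)"
  by (induction xs rule: path_edges.induct) auto

lemma path_edges_rev: "path_edges (rev xs) = path_edges xs"
proof (induction xs rule: path_edges.induct)
  case (1 x y zs)
  then show ?case by (simp add: path_edges_append[of "rev zs" y "[x]"] insert_commute)
qed auto

lemma path_graph_rev: "path_graph (rev xs) = path_graph xs"
  by (simp add: path_graph_eq path_edges_rev)

lemma path_edges_subset: "e \<in> path_edges xs \<Longrightarrow> e \<subseteq> set xs"
  by (induction xs rule: path_edges.induct) auto

lemma card_path_edge: "distinct xs \<Longrightarrow> e \<in> path_edges xs \<Longrightarrow> card e = 2"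
  by (induction xs rule: path_edges.induct) auto

lemma subgraph_path_graph:
  assumes "distinct xs"
  shows "subgraph (path_graph xs) G \<longleftrightarrow> set xs \<subseteq> verts G \<and> path_edges xs \<subseteq> edges G"
  using card_path_edge[OF assms] path_edges_subset[of _ xs]
  by (auto simp: subgraph_def simple_graph_def path_graph_eq)

text \<open>Positions are counted from 1, so that in a path of odd order the even positions are the
  smaller colour class: they cover all edges, and both ends lie outside.\<close>

fun even_positions :: "'a list \<Rightarrow> 'a set" where
  "even_positions (x # y # zs) = insert y (even_positions zs)"
| "even_positions _ = {}"

lemma even_positions_append:
  "even (length xs) \<Longrightarrow> even_positions (xs @ ys) = even_positions xs \<union> even_positions ys"
  by (induction xs rule: even_positions.induct) auto

lemma even_positions_rev:
  "odd (length xs) \<Longrightarrow> even_positions (rev xs) = even_positions xs"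
proof (induction xs rule: even_positions.induct)
  case (1 x y zs)
  have "even_positions (rev (x # y # zs)) = even_positions ((rev zs @ [y]) @ [x])" by simp
  also have "\<dots> = even_positions (rev zs @ [y])"
    using 1 by (subst even_positions_append) auto
  also have "\<dots> = insert y (even_positions (rev zs))"
  proof -
    have "even_positions (us @ [y]) = insert y (even_positions us)" if "odd (length us)" for us
      using that by (induction us rule: even_positions.induct) auto
    then show ?thesis using 1 by simp
  qed
  finally show ?case using 1 by simp
qed auto

lemma split_at_even_position:
  "y \<in> even_positions xs \<Longrightarrow> \<exists>as bs p. xs = as @ p # y # bs \<and> even (length as)"
proof (induction xs rule: even_positions.induct)
  case (1 u v zs)
  show ?case
  proof (cases "y = v")
    case True
    then show ?thesis by - (rule exI[of _ "[]"], auto)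
  next
    case False
    then obtain as bs p where "zs = as @ p # y # bs" "even (length as)" using 1 by auto
    then show ?thesis by - (rule exI[of _ "u # v # as"], auto)
  qed
qed auto

lemma split_at_odd_position:
  "y \<in> set xs \<Longrightarrow> y \<notin> even_positions xs \<Longrightarrow> \<exists>as bs. xs = as @ y # bs \<and> even (length as)"
proof (induction xs rule: even_positions.induct)
  case (1 u v zs)
  show ?case
  proof (cases "y = u")
    case True
    then show ?thesis by - (rule exI[of _ "[]"], auto)
  next
    case False
    then obtain as bs where "zs = as @ y # bs" "even (length as)" using 1 by auto
    then show ?thesis by - (rule exI[of _ "u # v # as"], auto)
  qed
next
  case ("2_2" v)
  then show ?case by (intro exI[of _ "[]"]) auto
qed auto

section \<open>Matchings and path covers\<close>

fun alternate_edges :: "'a list \<Rightarrow> 'a set set" where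
  "alternate_edges (x # y # zs) = insert {x, y} (alternate_edges zs)"
| "alternate_edges _ = {}"

lemma alternate_edges_subset: "alternate_edges xs \<subseteq> path_edges xs"
proof (induction xs rule: alternate_edges.induct)
  case (1 x y zs)
  then show ?case by (cases zs) auto
qed auto

lemma alternate_edges_matching:
  "distinct xs \<Longrightarrow> pairwise disjnt (alternate_edges xs) \<and> finite (alternate_edges xs) \<and>
     card (alternate_edges xs) = length xs div 2 \<and> \<Union> (alternate_edges xs) \<subseteq> set xs"
proof (induction xs rule: alternate_edges.induct)
  case (1 x y zs)
  then have IH: "pairwise disjnt (alternate_edges zs)" "finite (alternate_edges zs)"
    "card (alternate_edges zs) = length zs div 2" "\<Union> (alternate_edges zs) \<subseteq> set zs" by auto
  then have "{x, y} \<notin> alternate_edges zs" "\<forall>e\<in>alternate_edges zs. disjnt {x, y} e"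
    using 1(2) by (auto simp: disjnt_def)
  with IH show ?case by (auto simp: pairwise_insert disjnt_sym)
qed auto

text \<open>Removing a vertex at an odd position from a path of odd order leaves two paths of even order,
  which have perfect matchings.\<close>

lemma near_perfect_matching_avoiding_odd_position:
  assumes "distinct xs" "odd (length xs)" "y \<in> set xs" "y \<notin> even_positions xs"
  shows "\<exists>M. M \<subseteq> path_edges xs \<and> pairwise disjnt M \<and> finite M \<and>
    card M = length xs div 2 \<and> y \<notin> \<Union> M"
proof -
  obtain as bs where xs: "xs = as @ y # bs" and as: "even (length as)"
    using split_at_odd_position assms by metis
  have bs: "even (length bs)" using assms(2) as xs by simp
  let ?M = "alternate_edges as \<union> alternate_edges bs"
  have d: "distinct as" "distinct bs" "set as \<inter> set bs = {}" "y \<notin> set as" "y \<notin> set bs"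
    using assms(1) xs by auto
  note A = alternate_edges_matching[OF d(1)] and B = alternate_edges_matching[OF d(2)]
  have cross: "disjnt e f" if "e \<in> alternate_edges as" "f \<in> alternate_edges bs" for e f
    using that A B d(3) unfolding disjnt_def by blast
  have "{} \<notin> alternate_edges as" for as :: "'a list"
    by (induction as rule: alternate_edges.induct) auto
  then have "alternate_edges as \<inter> alternate_edges bs = {}" using cross
    by (metis disjnt_iff disjoint_iff equals0I)
  then have "card ?M = length xs div 2"
    using A B as bs xs by (auto simp: card_Un_disjoint)
  moreover have "pairwise disjnt ?M"
    using A B cross unfolding pairwise_def by (auto simp: disjnt_sym)
  moreover have "?M \<subseteq> path_edges xs"
  proof -
    have "path_edges as \<subseteq> path_edges (as @ [y])"
      by (cases "as = []") (auto simp: path_edges_snoc)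
    moreover have "path_edges bs \<subseteq> path_edges (y # bs)"
      by (cases bs) auto
    ultimately show ?thesis
      using alternate_edges_subset[of as] alternate_edges_subset[of bs]
        path_edges_append[of as y bs] xs by auto
  qed
  ultimately show ?thesis using A B d by (intro exI[of _ ?M]) blast
qed

lemma finite_edges: "simple_graph G \<Longrightarrow> finite (edges G)"
  by (rule finite_subset[of _ "Pow (verts G)"]) (auto simp: simple_graph_def)

lemma finite_matchings: "simple_graph G \<Longrightarrow> finite {M. matching G M}"
  by (rule finite_subset[of _ "Pow (edges G)"]) (auto simp: matching_def finite_edges)

lemma card_matching_le: "simple_graph G \<Longrightarrow> matching G M \<Longrightarrow> card M \<le> matching_number G"
  unfolding matching_number_def using finite_matchings[of G] by (intro Max_ge) auto

lemma obtain_maximum_matching: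
  assumes "simple_graph G"
  obtains M where "matching G M" "card M = matching_number G"
proof -
  have "matching G {}" by (simp add: matching_def)
  then have "matching_number G \<in> card ` {M. matching G M}"
    unfolding matching_number_def using finite_matchings[OF assms] by (intro Max_in) auto
  then show ?thesis using that by auto
qed

lemma path_cover_iff:
  "path_cover G \<P> \<longleftrightarrow> (\<forall>P\<in>\<P>. is_path P \<and> subgraph P G) \<and> verts G = \<Union> (verts ` \<P>) \<and>
     pairwise (\<lambda>P Q. disjnt (verts P) (verts Q)) \<P>" (is "?L \<longleftrightarrow> ?R")
proof
  assume L: ?L
  then have sub: "verts P \<subseteq> verts G" if "P \<in> \<P>" for P
    using that by (auto simp: path_cover_def subgraph_def)
  have uniq: "P = Q" if "P \<in> \<P>" "Q \<in> \<P>" "v \<in> verts P" "v \<in> verts Q" for P Q v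
  proof -
    have "v \<in> verts G" using sub that by blast
    then have "\<exists>!P. P \<in> \<P> \<and> v \<in> verts P" using L by (simp add: path_cover_def)
    then show ?thesis using that by blast
  qed
  have "verts G \<subseteq> \<Union> (verts ` \<P>)"
  proof
    fix v assume "v \<in> verts G"
    then have "\<exists>!P. P \<in> \<P> \<and> v \<in> verts P" using L by (simp add: path_cover_def)
    then show "v \<in> \<Union> (verts ` \<P>)" by auto
  qed
  then have "verts G = \<Union> (verts ` \<P>)" using sub by blast
  moreover have "pairwise (\<lambda>P Q. disjnt (verts P) (verts Q)) \<P>"
  proof (rule pairwiseI)
    fix P Q assume "P \<in> \<P>" "Q \<in> \<P>" "P \<noteq> Q"
    then show "disjnt (verts P) (verts Q)" using uniq[of P Q] unfolding disjnt_iff by blast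
  qed
  ultimately show ?R using L by (simp add: path_cover_def)
next
  assume R: ?R
  have "\<exists>!P. P \<in> \<P> \<and> v \<in> verts P" if v: "v \<in> verts G" for v
  proof -
    obtain P where P: "P \<in> \<P>" "v \<in> verts P" using R v by blast
    moreover have "Q = P" if "Q \<in> \<P>" "v \<in> verts Q" for Q
    proof (rule ccontr)
      assume "Q \<noteq> P"
      then have "disjnt (verts Q) (verts P)"
        by (rule pairwiseD[OF conjunct2[OF conjunct2[OF R]] that(1) P(1)])
      then show False using P(2) that(2) by (simp add: disjnt_iff)
    qed
    ultimately show ?thesis by blast
  qed
  then show ?L using R by (simp add: path_cover_def)
qed

lemma finite_path_covers:
  assumes "simple_graph G"
  shows "finite {\<P>. path_cover G \<P>}"
proof -
  have "{\<P>. path_cover G \<P>} \<subseteq> Pow (Pow (verts G) \<times> Pow (edges G))"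
    by (fastforce simp: path_cover_def subgraph_def)
  moreover have "finite (Pow (Pow (verts G) \<times> Pow (edges G)))"
    using assms finite_edges[OF assms] by (simp add: simple_graph_def)
  ultimately show ?thesis by (rule finite_subset)
qed

lemma finite_path_cover:
  assumes "simple_graph G" "path_cover G \<P>"
  shows "finite \<P>"
proof -
  have "\<P> \<subseteq> Pow (verts G) \<times> Pow (edges G)"
    using assms(2) by (fastforce simp: path_cover_def subgraph_def)
  moreover have "finite (Pow (verts G) \<times> Pow (edges G))"
    using assms finite_edges[OF assms(1)] by (simp add: simple_graph_def)
  ultimately show ?thesis by (rule finite_subset)
qed

lemma path_covering_number_le:
  "simple_graph G \<Longrightarrow> path_cover G \<P> \<Longrightarrow> path_covering_number G \<le> card \<P>"
  unfolding path_covering_number_def using finite_path_covers[of G] by (intro Min_le) auto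

lemma obtain_minimum_path_cover:
  assumes "simple_graph G"
  obtains \<P> where "path_cover G \<P>" "card \<P> = path_covering_number G"
proof -
  have "path_cover G ((\<lambda>v. path_graph [v]) ` verts G)"
    by (auto simp: path_cover_iff pairwise_def disjnt_def is_path_def subgraph_path_graph
        path_graph_eq subgraph_def simple_graph_def intro!: exI[of _ "[_]"])
  then have "path_covering_number G \<in> card ` {\<P>. path_cover G \<P>}"
    unfolding path_covering_number_def using finite_path_covers[OF assms] by (intro Min_in) auto
  then show ?thesis using that by auto
qed

text \<open>A path cover of a spanning subgraph is one of the whole graph.\<close>

lemma path_covering_number_spanning_subgraph:
  assumes "simple_graph G" "subgraph T G" "verts T = verts G"
  shows "path_covering_number G \<le> path_covering_number T"
proof -
  have T: "simple_graph T" using assms(2) by (simp add: subgraph_def)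
  obtain \<P> where "path_cover T \<P>" "card \<P> = path_covering_number T"
    using obtain_minimum_path_cover[OF T] by blast
  moreover have "subgraph P G" if "subgraph P T" for P
    using that assms(2) by (meson order_trans subgraph_def)
  with \<open>path_cover T \<P>\<close> have "path_cover G \<P>"
    using assms(3) by (simp add: path_cover_def)
  ultimately show ?thesis using path_covering_number_le[OF assms(1)] by metis
qed

lemma path_cover_sum_card:
  assumes "simple_graph G" "path_cover G \<P>"
  shows "(\<Sum>P\<in>\<P>. card (verts P)) = order G"
proof -
  have fin: "finite (verts P)" if "P \<in> \<P>" for P
    using assms(2) that by (auto simp: path_cover_def subgraph_def simple_graph_def)
  have "card (\<Union>P\<in>\<P>. verts P) = (\<Sum>P\<in>\<P>. card (verts P))"
    using finite_path_cover[OF assms] assms(2) fin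
    by (intro card_UN_disjoint) (auto simp: path_cover_iff pairwise_def disjnt_def)
  then show ?thesis using assms(2) by (simp add: order_def path_cover_iff)
qed

lemma path_cover_union_matching:
  assumes G: "simple_graph G" and cov: "path_cover G \<P>"
    and m: "\<And>P. P \<in> \<P> \<Longrightarrow> m P \<subseteq> edges P \<and> pairwise disjnt (m P)"
  shows "matching G (\<Union>P\<in>\<P>. m P)" "card (\<Union>P\<in>\<P>. m P) = (\<Sum>P\<in>\<P>. card (m P))"
proof -
  have sub: "m P \<subseteq> edges G" "\<And>e. e \<in> m P \<Longrightarrow> e \<subseteq> verts P \<and> e \<noteq> {}" if "P \<in> \<P>" for P
    using m[OF that] cov that by (fastforce simp: path_cover_def subgraph_def simple_graph_def)+
  have dis: "disjnt e f" if "P \<in> \<P>" "Q \<in> \<P>" "P \<noteq> Q" "e \<in> m P" "f \<in> m Q" for P Q e f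
  proof -
    have "disjnt (verts P) (verts Q)"
      using cov that by (auto simp: path_cover_iff pairwise_def)
    then show ?thesis using sub(2) that unfolding disjnt_def by blast
  qed
  have "disjnt e f" if "e \<in> m P" "f \<in> m Q" "e \<noteq> f" "P \<in> \<P>" "Q \<in> \<P>" for e f P Q
    using dis[of P Q e f] m[of P] that by (cases "P = Q") (auto simp: pairwise_def)
  then show "matching G (\<Union>P\<in>\<P>. m P)"
    using sub(1) unfolding matching_def pairwise_def by blast
  have "m P \<inter> m Q = {}" if "P \<in> \<P>" "Q \<in> \<P>" "P \<noteq> Q" for P Q
  proof (rule equals0I)
    fix e assume "e \<in> m P \<inter> m Q"
    then have "disjnt e e" "e \<noteq> {}" using dis[OF that] sub(2)[OF that(1)] by blast+
    then show False unfolding disjnt_def by simp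
  qed
  moreover have "finite (m P)" if "P \<in> \<P>" for P
    using sub(1)[OF that] finite_edges[OF G] finite_subset by blast
  ultimately show "card (\<Union>P\<in>\<P>. m P) = (\<Sum>P\<in>\<P>. card (m P))"
    using finite_path_cover[OF G cov] by (intro card_UN_disjoint) auto
qed

text \<open>The members of a cover are graphs; since a path can be traversed in two directions, working
  with positions requires choosing a traversal of each of them.\<close>

lemma obtain_traversals:
  assumes "path_cover G \<P>"
  obtains r where "\<And>P. P \<in> \<P> \<Longrightarrow> r P \<noteq> [] \<and> distinct (r P) \<and> P = path_graph (r P)"
proof -
  have "\<forall>P\<in>\<P>. \<exists>xs. xs \<noteq> [] \<and> distinct xs \<and> P = path_graph xs"
    using assms by (auto simp: path_cover_def is_path_def)
  then show ?thesis using that by metis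
qed

text \<open>Matching alternate edges inside a path of order \<open>k\<close> misses at most one vertex, so a cover by
  \<open>p\<close> paths yields a matching missing at most \<open>p\<close> vertices.\<close>

lemma order_le_matching_path_cover:
  assumes "simple_graph G" "path_cover G \<P>"
  shows "order G \<le> 2 * matching_number G + card \<P>"
proof -
  obtain r where r: "\<And>P. P \<in> \<P> \<Longrightarrow> r P \<noteq> [] \<and> distinct (r P) \<and> P = path_graph (r P)"
    using obtain_traversals[OF assms(2)] by blast
  let ?m = "\<lambda>P. alternate_edges (r P)"
  have vr: "verts P = set (r P)" "edges P = path_edges (r P)" if "P \<in> \<P>" for P
    using r[OF that] by (metis path_graph_eq fst_conv snd_conv)+
  have m: "?m P \<subseteq> edges P \<and> pairwise disjnt (?m P)" if "P \<in> \<P>" for P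
    using alternate_edges_matching[of "r P"] alternate_edges_subset[of "r P"] r[OF that] vr[OF that]
    by auto
  have "(\<Sum>P\<in>\<P>. card (?m P)) \<le> matching_number G"
    using path_cover_union_matching[OF assms m] card_matching_le[OF assms(1)] by metis
  moreover have "card (verts P) \<le> 2 * card (?m P) + 1" if "P \<in> \<P>" for P
    using alternate_edges_matching[of "r P"] r[OF that] vr(1)[OF that]
    by (simp add: distinct_card)
  then have "order G \<le> (\<Sum>P\<in>\<P>. 2 * card (?m P) + 1)"
    unfolding path_cover_sum_card[OF assms, symmetric] by (rule sum_mono)
  ultimately show ?thesis
    unfolding sum.distrib sum_distrib_left[symmetric] by simp
qed

lemma order_le_matching_path_covering_number:
  "simple_graph G \<Longrightarrow> order G \<le> 2 * matching_number G + path_covering_number G"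
  using obtain_minimum_path_cover order_le_matching_path_cover by metis

section \<open>Labeled trees of the family attain equality\<close>

lemma connected_add_leaf:
  assumes conn: "connected_graph (V, E)" and v: "v \<in> V" and u: "u \<notin> V"
  shows "connected_graph (insert u V, insert {v, u} E)"
proof -
  let ?joined = "\<lambda>V E a b. \<exists>xs. xs \<noteq> [] \<and> distinct xs \<and> hd xs = a \<and> last xs = b \<and>
    set xs \<subseteq> V \<and> path_edges xs \<subseteq> E"
  have old: "?joined V E a b" if "a \<in> V" "b \<in> V" for a b
  proof -
    have "\<exists>xs. xs \<noteq> [] \<and> distinct xs \<and> hd xs = a \<and> last xs = b \<and> subgraph (path_graph xs) (V, E)"
      using conn that by (simp add: connected_graph_def)
    then obtain xs where xs: "xs \<noteq> []" "distinct xs" "hd xs = a" "last xs = b"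
      "subgraph (path_graph xs) (V, E)" by (elim exE conjE)
    then have "set xs \<subseteq> V" "path_edges xs \<subseteq> E"
      using subgraph_path_graph[OF xs(2), of "(V, E)"] by simp_all
    with xs show ?thesis by (intro exI[of _ xs] conjI)
  qed
  have leaf_last: "?joined (insert u V) (insert {v, u} E) a u" if a: "a \<in> V" for a
  proof -
    obtain xs where "xs \<noteq> []" "distinct xs" "hd xs = a" "last xs = v" "set xs \<subseteq> V" "path_edges xs \<subseteq> E"
      using old[OF a v] by blast
    then show ?thesis using u by (intro exI[of _ "xs @ [u]"]) (auto simp: path_edges_snoc)
  qed
  have leaf_first: "?joined (insert u V) (insert {v, u} E) u b" if b: "b \<in> V" for b
  proof -
    obtain xs where "xs \<noteq> []" "distinct xs" "hd xs = v" "last xs = b" "set xs \<subseteq> V" "path_edges xs \<subseteq> E"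
      using old[OF v b] by blast
    then show ?thesis using u
      by (intro exI[of _ "u # xs"]) (auto simp: path_edges_Cons insert_commute)
  qed
  have "?joined (insert u V) (insert {v, u} E) a b" if "a \<in> insert u V" "b \<in> insert u V" for a b
  proof (cases "a = u"; cases "b = u")
    assume "a = u" "b = u"
    then show ?thesis by (intro exI[of _ "[u]"]) auto
  next
    assume "a = u" "b \<noteq> u"
    then show ?thesis using leaf_first that by blast
  next
    assume "a \<noteq> u" "b = u"
    then show ?thesis using leaf_last that by blast
  next
    assume "a \<noteq> u" "b \<noteq> u"
    then have ab: "a \<in> V" "b \<in> V" using that by simp_all
    from old[OF ab] obtain xs where "xs \<noteq> []" "distinct xs" "hd xs = a" "last xs = b"
      "set xs \<subseteq> V" "path_edges xs \<subseteq> E" by (elim exE conjE)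
    then show ?thesis by (intro exI[of _ xs] conjI) auto
  qed
  then have "\<exists>xs. xs \<noteq> [] \<and> distinct xs \<and> hd xs = a \<and> last xs = b \<and>
      subgraph (path_graph xs) (insert u V, insert {v, u} E)"
    if "a \<in> insert u V" "b \<in> insert u V" for a b
    using that by (metis subgraph_path_graph fst_conv snd_conv)
  then show ?thesis unfolding connected_graph_def fst_conv by blast
qed

lemma cycle_has_two_neighbours:
  assumes "length xs \<ge> 3" "distinct xs" "u \<in> set xs"
  shows "\<exists>a b. a \<noteq> b \<and> {u, a} \<in> edges (cycle_graph xs) \<and> {u, b} \<in> edges (cycle_graph xs)"
proof -
  obtain i where i: "i < length xs" "xs ! i = u" using assms(3) by (auto simp: in_set_conv_nth)
  have step: "{xs ! j, xs ! Suc j} \<in> edges (cycle_graph xs)" if "Suc j < length xs" for j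
    using that by (auto simp: cycle_graph_def path_graph_def)
  have wrap: "{xs ! (length xs - 1), xs ! 0} \<in> edges (cycle_graph xs)"
    using assms(1) by (simp add: cycle_graph_def last_conv_nth hd_conv_nth flip: length_greater_0_conv)
  have neq: "xs ! j \<noteq> xs ! k" if "j < length xs" "k < length xs" "j \<noteq> k" for j k
    using that assms(2) nth_eq_iff_index_eq by blast
  consider "i = 0" | "i = length xs - 1" "i \<noteq> 0" | "0 < i" "Suc i < length xs" using i by linarith
  then show ?thesis
  proof cases
    case 1
    then show ?thesis using i step[of 0] wrap neq[of 1 "length xs - 1"] assms(1)
      by (intro exI[of _ "xs ! 1"] exI[of _ "xs ! (length xs - 1)"]) (auto simp: insert_commute)
  next
    case 2
    then have "Suc (i - 1) = i" "0 < length xs" using i by auto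
    then show ?thesis using 2 i step[of "i - 1"] wrap neq[of "i - 1" 0] assms(1)
      by (intro exI[of _ "xs ! (i - 1)"] exI[of _ "xs ! 0"])
        (simp add: insert_commute[of u])
  next
    case 3
    then have "Suc (i - 1) = i" by simp
    then show ?thesis using 3 i step[of "i - 1"] step[of i] neq[of "i - 1" "Suc i"]
      by (intro exI[of _ "xs ! (i - 1)"] exI[of _ "xs ! Suc i"]) (auto simp: insert_commute)
  qed
qed

lemma tree_add_leaf:
  assumes T: "tree (V, E)" and v: "v \<in> V" and u: "u \<notin> V"
  shows "tree (insert u V, insert {v, u} E)"
proof -
  have E: "\<forall>e\<in>E. e \<subseteq> V \<and> card e = 2" "finite V" using T by (auto simp: tree_def simple_graph_def)
  have uv: "u \<noteq> v" using u v by blast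
  have "simple_graph (insert u V, insert {v, u} E)"
    using E v uv by (auto simp: simple_graph_def)
  moreover have "connected_graph (insert u V, insert {v, u} E)"
    using T v u by (simp add: connected_add_leaf tree_def)
  moreover have "\<nexists>C. is_cycle C \<and> subgraph C (insert u V, insert {v, u} E)"
  proof (rule notI, elim exE conjE)
    fix C assume "is_cycle C" and sub: "subgraph C (insert u V, insert {v, u} E)"
    then obtain xs where xs: "length xs \<ge> 3" "distinct xs" "C = cycle_graph xs"
      using \<open>is_cycle C\<close> unfolding is_cycle_def by blast
    \<comment> \<open>A vertex of a cycle has two neighbours on it, whereas \<open>u\<close> has only the neighbour \<open>v\<close>.\<close>
    have "u \<notin> set xs"
    proof
      assume "u \<in> set xs"
      then obtain a b where "a \<noteq> b" "{u, a} \<in> edges C" "{u, b} \<in> edges C"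
        using cycle_has_two_neighbours xs by metis
      moreover have "w = v" if "{u, w} \<in> edges C" for w
      proof -
        have "{u, w} \<in> insert {v, u} E" using that sub by (auto simp: subgraph_def)
        moreover have "{u, w} \<notin> E" using E u by blast
        ultimately show ?thesis using uv by (auto simp: doubleton_eq_iff)
      qed
      ultimately show False by metis
    qed
    moreover have "verts C = set xs" using xs by (simp add: cycle_graph_def)
    ultimately have "u \<notin> verts C" by simp
    then have "verts C \<subseteq> V" "simple_graph C" "\<forall>e\<in>edges C. u \<notin> e"
      using sub by (auto simp: subgraph_def simple_graph_def)
    moreover from this have "edges C \<subseteq> E" using sub by (auto simp: subgraph_def)
    ultimately have "verts C \<subseteq> V" "edges C \<subseteq> E" "simple_graph C" by auto
    then have "subgraph C (V, E)" by (simp add: subgraph_def)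
    moreover have "\<nexists>C. is_cycle C \<and> subgraph C (V, E)" using T unfolding tree_def by (elim conjE)
    ultimately show False using \<open>is_cycle C\<close> by metis
  qed
  ultimately show ?thesis unfolding tree_def by (intro conjI)
qed

lemma tree_singleton: "tree ({v}, {})"
proof -
  have "connected_graph ({v}, {})"
    by (auto simp: connected_graph_def subgraph_path_graph intro!: exI[of _ "[v]"])
  moreover have "\<not> subgraph C ({v}, {})" if "is_cycle C" for C
    using that by (auto simp: is_cycle_def subgraph_def cycle_graph_def)
  ultimately show ?thesis by (auto simp: tree_def simple_graph_def)
qed

lemma labeled_family_labeling: "(T, SA, SB, SC) \<in> labeled_family \<Longrightarrow> labeling_of T (SA, SB, SC)"
proof (induction rule: labeled_family.induct)
  case (P3 u v w)
  then show ?case by (auto simp: path_graph_eq)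
next
  case (O1 V E SA SB SC v u1)
  then show ?case by auto
next
  case (O2 V E SA SB SC v u1 u2)
  then show ?case by auto
next
  case (O3 V E SA SB SC v u1 u2 u3)
  then show ?case by auto
next
  case (O4 V E SA SB SC v u1 u2 u3 u4 u5)
  then show ?case by auto
qed

lemma labeled_family_labeling_sets:
  assumes "((V, E), (SA, SB, SC)) \<in> labeled_family"
  shows "SA \<union> SB \<union> SC = V" "SA \<inter> SB = {}"
  using labeled_family_labeling[OF assms] by auto

text \<open>Each operation attaches its new vertices as successive leaves.\<close>

lemma labeled_family_tree: "(T, SA, SB, SC) \<in> labeled_family \<Longrightarrow> tree T"
proof (induction rule: labeled_family.induct)
  case (P3 u v w)
  then have "tree (insert w (insert u {v}), insert {v, w} (insert {v, u} {}))"
    by (intro tree_add_leaf tree_singleton) auto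
  then show ?case by (simp add: path_graph_eq insert_commute)
next
  case (O1 V E SA SB SC v u1)
  then have "v \<in> V" using labeled_family_labeling_sets by blast
  with O1 show ?case by (simp add: tree_add_leaf)
next
  case (O2 V E SA SB SC v u1 u2)
  then have "v \<in> V" using labeled_family_labeling_sets by blast
  with O2 have "tree (insert u2 (insert u1 V), insert {u1, u2} (insert {v, u1} E))"
    by (intro tree_add_leaf) auto
  then show ?case by (simp add: insert_commute)
next
  case (O3 V E SA SB SC v u1 u2 u3)
  then have "tree (insert u3 (insert u1 (insert u2 V)),
    insert {u2, u3} (insert {u2, u1} (insert {v, u2} E)))"
    by (intro tree_add_leaf) auto
  then show ?case by (simp add: insert_commute)
next
  case (O4 V E SA SB SC v u1 u2 u3 u4 u5)
  then have "v \<in> V" using labeled_family_labeling_sets by blast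
  with O4 have "tree (insert u5 (insert u4 (insert u1 (insert u2 (insert u3 V)))),
    insert {u4, u5} (insert {u3, u4} (insert {u2, u1} (insert {u3, u2} (insert {v, u3} E)))))"
    by (intro tree_add_leaf) auto
  then show ?case by (simp add: insert_commute)
qed

lemma labeled_family_status_A_vertex_cover:
  "(T, SA, SB, SC) \<in> labeled_family \<Longrightarrow> \<forall>e\<in>edges T. e \<inter> SA \<noteq> {}"
proof (induction rule: labeled_family.induct)
  case (P3 u v w)
  then show ?case by (auto simp: path_graph_eq)
qed auto

lemma matching_number_le_vertex_cover:
  assumes G: "simple_graph G" and "finite A" and cov: "\<forall>e\<in>edges G. e \<inter> A \<noteq> {}"
  shows "matching_number G \<le> card A"
proof -
  obtain M where M: "matching G M" "card M = matching_number G"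
    using obtain_maximum_matching[OF G] by blast
  have "\<forall>e\<in>M. \<exists>a. a \<in> e \<inter> A" using M(1) cov by (auto simp: matching_def)
  then obtain f where f: "\<And>e. e \<in> M \<Longrightarrow> f e \<in> e \<inter> A" by metis
  have "inj_on f M"
  proof (rule inj_onI)
    fix e e' assume "e \<in> M" "e' \<in> M" "f e = f e'"
    then show "e = e'" using f[of e] f[of e'] M(1)
      unfolding matching_def pairwise_def disjnt_iff by (metis IntD1)
  qed
  then have "card M \<le> card A" using f \<open>finite A\<close> by (intro card_inj_on_le[of f]) auto
  then show ?thesis using M(2) by simp
qed

lemma path_cover_add_path:
  assumes cov: "path_cover (V, E) \<P>" and ys: "ys \<noteq> []" "distinct ys" "set ys \<inter> V = {}"
    and V': "V' = V \<union> set ys" and E': "E \<union> path_edges ys \<subseteq> E'"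
  shows "path_cover (V', E') (insert (path_graph ys) \<P>)"
  unfolding path_cover_iff
proof (intro conjI)
  have old: "subgraph P (V, E)" "is_path P" if "P \<in> \<P>" for P using cov that by (auto simp: path_cover_def)
  have "subgraph P (V', E')" if "P \<in> \<P>" for P
    using old(1)[OF that] V' E' by (auto simp: subgraph_def)
  moreover have "subgraph (path_graph ys) (V', E')" "is_path (path_graph ys)"
    using ys V' E' by (auto simp: subgraph_path_graph is_path_def)
  ultimately show "\<forall>P\<in>insert (path_graph ys) \<P>. is_path P \<and> subgraph P (V', E')" using old by blast
  show "verts (V', E') = \<Union> (verts ` insert (path_graph ys) \<P>)"
    using cov V' by (auto simp: path_cover_iff path_graph_eq)
  have "verts P \<subseteq> V" if "P \<in> \<P>" for P using old(1)[OF that] by (simp add: subgraph_def)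
  then have "disjnt (set ys) (verts P)" if "P \<in> \<P>" for P using ys(3) that by (fastforce simp: disjnt_def)
  then show "pairwise (\<lambda>P Q. disjnt (verts P) (verts Q)) (insert (path_graph ys) \<P>)"
    using cov by (auto simp: path_cover_iff pairwise_insert path_graph_eq disjnt_sym)
qed

text \<open>A path of the cover is lengthened by dissolving it and inserting the longer path afresh.\<close>

lemma path_cover_extend_path:
  assumes cov: "path_cover (V, E) \<P>" and xs: "path_graph xs \<in> \<P>" "xs \<noteq> []" "distinct (xs @ ys)"
    "set ys \<inter> V = {}"
    and V': "V' = V \<union> set ys" and E': "E \<union> path_edges (xs @ ys) \<subseteq> E'"
  shows "path_cover (V', E') (insert (path_graph (xs @ ys)) (\<P> - {path_graph xs}))"
proof -
  let ?\<Q> = "\<P> - {path_graph xs}"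
  have dis: "set xs \<inter> verts P = {}" if "P \<in> ?\<Q>" for P
  proof -
    have "disjnt (verts (path_graph xs)) (verts P)"
      using cov xs(1) that unfolding path_cover_iff by (metis DiffE pairwiseD singletonI)
    then show ?thesis by (simp add: path_graph_eq disjnt_def)
  qed
  have V: "V = set xs \<union> \<Union> (verts ` ?\<Q>)"
  proof -
    have "V = \<Union> (verts ` \<P>)" using cov by (simp add: path_cover_iff)
    moreover have "\<P> = insert (path_graph xs) ?\<Q>" using xs(1) by blast
    moreover have "verts (path_graph xs) = set xs" by (simp add: path_graph_eq)
    ultimately show ?thesis by (metis UN_insert)
  qed
  have "path_cover (V - set xs, E) ?\<Q>"
    unfolding path_cover_iff
  proof (intro conjI)
    have eq: "V - set xs = \<Union> (verts ` ?\<Q>)" using V dis by blast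
    then show "verts (V - set xs, E) = \<Union> (verts ` ?\<Q>)" by simp
    have "is_path P \<and> subgraph P (V, E)" if "P \<in> ?\<Q>" for P
      using cov that by (simp add: path_cover_def)
    moreover have "verts P \<subseteq> V - set xs" if "P \<in> ?\<Q>" for P using eq that by blast
    ultimately show "\<forall>P\<in>?\<Q>. is_path P \<and> subgraph P (V - set xs, E)"
      by (simp add: subgraph_def)
    show "pairwise (\<lambda>P Q. disjnt (verts P) (verts Q)) ?\<Q>"
      using cov by (auto simp: path_cover_iff intro: pairwise_subset)
  qed
  moreover have "set xs \<subseteq> V" using V by blast
  ultimately show ?thesis
    using xs V' E' by (intro path_cover_add_path[where V = "V - set xs" and E = E]) auto
qed

definition path_end :: "'a ugraph set \<Rightarrow> 'a \<Rightarrow> bool" where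
  "path_end \<P> b \<longleftrightarrow> (\<exists>xs. xs \<noteq> [] \<and> distinct xs \<and> last xs = b \<and> path_graph xs \<in> \<P>)"

lemma path_end_mono: "path_end \<P> b \<Longrightarrow> \<P> \<subseteq> \<Q> \<Longrightarrow> path_end \<Q> b"
  by (auto simp: path_end_def)

lemma path_end_insert:
  assumes "ys \<noteq> []" "distinct ys"
  shows "path_end (insert (path_graph ys) \<P>) (hd ys)" "path_end (insert (path_graph ys) \<P>) (last ys)"
  using assms path_graph_rev[of ys] unfolding path_end_def
  by (metis distinct_rev insertI1 last_rev rev_is_Nil_conv, metis insertI1)

text \<open>A path determines its ends up to order: an end lies on one edge of the path, and any other
  vertex on two.\<close>

lemma path_graph_ends:
  assumes "xs \<noteq> []" "distinct xs" "ys \<noteq> []" "distinct ys" "path_graph xs = path_graph ys"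
  shows "last ys = hd xs \<or> last ys = last xs"
proof (rule ccontr)
  assume not_end: "\<not> ?thesis"
  have eq: "set xs = set ys" "path_edges xs = path_edges ys" using assms(5) by (auto simp: path_graph_eq)
  obtain zs b where ys: "ys = zs @ [b]" using assms(3) by (metis rev_exhaust)
  have unique: "a = last zs" if "{b, a} \<in> path_edges ys" for a
  proof -
    have "zs \<noteq> []" using that ys by auto
    moreover have "{b, a} \<notin> path_edges zs" using path_edges_subset[of _ zs] ys assms(4) by fastforce
    moreover have "b \<noteq> last zs" using \<open>zs \<noteq> []\<close> ys assms(4) by auto
    ultimately show ?thesis using that ys by (auto simp: path_edges_snoc doubleton_eq_iff)
  qed
  have "b \<in> set xs" using eq ys by simp
  then obtain us vs where xs: "xs = us @ b # vs" by (meson split_list)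
  then have "us \<noteq> []" "vs \<noteq> []" using not_end ys by auto
  then have "{b, last us} \<in> path_edges xs" "{b, hd vs} \<in> path_edges xs"
    using xs path_edges_append[of us b vs] by (auto simp: path_edges_snoc path_edges_Cons insert_commute)
  then have "last us = hd vs" using unique eq by metis
  then show False using assms(2) xs \<open>us \<noteq> []\<close> \<open>vs \<noteq> []\<close> by (auto dest: last_in_set hd_in_set)
qed

text \<open>The operations keep a path cover in which every vertex of status \<open>B\<close> is an end of its path.
  All but \<open>O2\<close> insert a new path of odd order; \<open>O2\<close> prolongs the path ending in \<open>v\<close>, which thereby
  stops being an end, in accordance with its new status. The number of vertices grows by twice the
  number of new \<open>A\<close>-vertices, plus one whenever there is a new path.\<close>

lemma labeled_family_path_cover:
  assumes "(T, SA, SB, SC) \<in> labeled_family"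
  shows "\<exists>\<P>. path_cover T \<P> \<and> card \<P> + 2 * card SA \<le> card (verts T) \<and>
    (\<forall>b\<in>SB. path_end \<P> b)"
  using assms
proof (induction rule: labeled_family.induct)
  case (P3 u v w)
  have "path_cover (path_graph [u, v, w]) {path_graph [u, v, w]}"
    using P3 by (auto simp: path_cover_iff is_path_def subgraph_path_graph path_graph_eq[of "[u, v, w]", symmetric]
        intro!: exI[of _ "[u, v, w]"]) (auto simp: path_graph_eq)
  moreover have "path_end {path_graph [u, v, w]} u" "path_end {path_graph [u, v, w]} w"
    using path_end_insert[of "[u, v, w]" "{}"] P3 by auto
  ultimately show ?case using P3 by (intro exI[of _ "{path_graph [u, v, w]}"]) (auto simp: path_graph_eq)
next
  case (O1 V E SA SB SC v u1)
  obtain \<P> where \<P>: "path_cover (V, E) \<P>" "card \<P> + 2 * card SA \<le> card V" "\<forall>b\<in>SB. path_end \<P> b"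
    using O1.IH by auto
  have fin: "finite V" using labeled_family_tree[OF O1.hyps(1)] by (simp add: tree_def simple_graph_def)
  let ?\<Q> = "insert (path_graph [u1]) \<P>"
  have "path_cover (V \<union> {u1}, E \<union> {{v, u1}}) ?\<Q>"
    using O1.hyps by (intro path_cover_add_path[OF \<P>(1)]) auto
  moreover have "card ?\<Q> \<le> Suc (card \<P>)" by (rule card_insert_le_m1) auto
  moreover have "\<forall>b\<in>SB \<union> {u1}. path_end ?\<Q> b"
    using \<P>(3) path_end_mono[of \<P> _ ?\<Q>] path_end_insert[of "[u1]" \<P>] by auto
  ultimately show ?case using \<P>(2) fin O1.hyps by (intro exI[of _ ?\<Q>]) auto
next
  case (O2 V E SA SB SC v u1 u2)
  obtain \<P> where \<P>: "path_cover (V, E) \<P>" "card \<P> + 2 * card SA \<le> card V" "\<forall>b\<in>SB. path_end \<P> b"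
    using O2.IH by auto
  have simp: "simple_graph (V, E)" using labeled_family_tree[OF O2.hyps(1)] by (simp add: tree_def)
  then have fin: "finite V" by (simp add: simple_graph_def)
  have SA: "SA \<subseteq> V" using labeled_family_labeling_sets[OF O2.hyps(1)] by blast
  obtain xs where xs: "xs \<noteq> []" "distinct xs" "last xs = v" "path_graph xs \<in> \<P>"
    using \<P>(3) O2.hyps(2) by (auto simp: path_end_def)
  have sub: "set xs \<subseteq> V" "path_edges xs \<subseteq> E"
    using \<P>(1) xs(2,4) subgraph_path_graph[of xs "(V, E)"] by (auto simp: path_cover_def)
  let ?new = "xs @ [u1, u2]" let ?\<Q> = "insert (path_graph ?new) (\<P> - {path_graph xs})"
  have new: "distinct ?new" using xs(2) sub O2.hyps by auto
  have edges: "path_edges ?new = path_edges xs \<union> {{v, u1}, {u1, u2}}"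
    using xs path_edges_append[of xs u1 "[u2]"] by (auto simp: path_edges_snoc)
  have "path_cover (V \<union> {u1, u2}, E \<union> {{v, u1}, {u1, u2}}) ?\<Q>"
    using O2.hyps xs sub new edges by (intro path_cover_extend_path[OF \<P>(1)]) auto
  moreover have "card ?\<Q> \<le> card \<P>"
    using card_insert_le_m1[of "card \<P>"] finite_path_cover[OF simp \<P>(1)] xs(4)
    by (metis card.remove card_insert_le_m1 diff_Suc_1 finite_Diff le_refl zero_less_Suc)
  moreover have "path_end ?\<Q> b" if b: "b \<in> SB - {v} \<union> {u2}" for b
  proof (cases "b = u2")
    case True
    then show ?thesis using path_end_insert(2)[of ?new] new by simp
  next
    case False
    then obtain ys where ys: "ys \<noteq> []" "distinct ys" "last ys = b" "path_graph ys \<in> \<P>"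
      using \<P>(3) b by (auto simp: path_end_def)
    show ?thesis
    proof (cases "path_graph ys = path_graph xs")
      case False
      then show ?thesis using ys by (auto simp: path_end_def)
    next
      case True
      then have "b = hd xs"
        using path_graph_ends[of xs ys] xs ys False b by auto
      then show ?thesis using path_end_insert(1)[of ?new] new xs(1) by simp
    qed
  qed
  ultimately show ?case using \<P>(2) fin O2.hyps SA
    by (intro exI[of _ ?\<Q>]) (auto simp: card_insert_if finite_subset)
next
  case (O3 V E SA SB SC v u1 u2 u3)
  obtain \<P> where \<P>: "path_cover (V, E) \<P>" "card \<P> + 2 * card SA \<le> card V" "\<forall>b\<in>SB. path_end \<P> b"
    using O3.IH by auto
  have fin: "finite V" using labeled_family_tree[OF O3.hyps(1)] by (simp add: tree_def simple_graph_def)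
  have SA: "SA \<subseteq> V" "finite SA"
    using labeled_family_labeling_sets[OF O3.hyps(1)] fin by (auto intro: finite_subset)
  let ?\<Q> = "insert (path_graph [u1, u2, u3]) \<P>"
  have "path_cover (V \<union> {u1, u2, u3}, E \<union> {{v, u2}, {u1, u2}, {u2, u3}}) ?\<Q>"
    using O3.hyps by (intro path_cover_add_path[OF \<P>(1)]) auto
  moreover have "card ?\<Q> \<le> Suc (card \<P>)" by (rule card_insert_le_m1) auto
  moreover have "\<forall>b\<in>SB - {v} \<union> {u1, u3}. path_end ?\<Q> b"
    using \<P>(3) path_end_mono[of \<P> _ ?\<Q>] path_end_insert[of "[u1, u2, u3]" \<P>] O3.hyps by auto
  moreover have "card (V \<union> {u1, u2, u3}) = card V + 3" "card (SA \<union> {u2}) = card SA + 1"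
    using fin SA O3.hyps by (auto simp: card_insert_if)
  ultimately show ?case using \<P>(2) by (intro exI[of _ ?\<Q>]) simp
next
  case (O4 V E SA SB SC v u1 u2 u3 u4 u5)
  obtain \<P> where \<P>: "path_cover (V, E) \<P>" "card \<P> + 2 * card SA \<le> card V" "\<forall>b\<in>SB. path_end \<P> b"
    using O4.IH by auto
  have fin: "finite V" using labeled_family_tree[OF O4.hyps(1)] by (simp add: tree_def simple_graph_def)
  have SA: "SA \<subseteq> V" "finite SA"
    using labeled_family_labeling_sets[OF O4.hyps(1)] fin by (auto intro: finite_subset)
  let ?\<Q> = "insert (path_graph [u1, u2, u3, u4, u5]) \<P>"
  have "path_cover (V \<union> {u1, u2, u3, u4, u5},
    E \<union> {{v, u3}, {u1, u2}, {u2, u3}, {u3, u4}, {u4, u5}}) ?\<Q>"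
    using O4.hyps by (intro path_cover_add_path[OF \<P>(1)]) auto
  moreover have "card ?\<Q> \<le> Suc (card \<P>)" by (rule card_insert_le_m1) auto
  moreover have "\<forall>b\<in>SB \<union> {u1, u5}. path_end ?\<Q> b"
    using \<P>(3) path_end_mono[of \<P> _ ?\<Q>] path_end_insert[of "[u1, u2, u3, u4, u5]" \<P>] O4.hyps by auto
  moreover have "card (V \<union> {u1, u2, u3, u4, u5}) = card V + 5" "card (SA \<union> {u2, u4}) = card SA + 2"
    using fin SA O4.hyps by (auto simp: card_insert_if)
  ultimately show ?case using \<P>(2) by (intro exI[of _ ?\<Q>]) simp
qed

lemma labeled_family_equality:
  assumes "(T, SA, SB, SC) \<in> labeled_family"
  shows "2 * matching_number T + path_covering_number T = order T"
proof -
  have T: "simple_graph T" using labeled_family_tree[OF assms] by (simp add: tree_def)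
  have "SA \<subseteq> verts T" using labeled_family_labeling[OF assms] by auto
  then have "finite SA" using T by (auto simp: simple_graph_def intro: finite_subset)
  then have "matching_number T \<le> card SA"
    using matching_number_le_vertex_cover[OF T] labeled_family_status_A_vertex_cover[OF assms] by blast
  moreover obtain \<P> where "path_cover T \<P>" "card \<P> + 2 * card SA \<le> order T"
    using labeled_family_path_cover[OF assms] by (auto simp: order_def)
  moreover have "path_covering_number T \<le> card \<P>"
    using path_covering_number_le T \<open>path_cover T \<P>\<close> by blast
  ultimately show ?thesis using order_le_matching_path_covering_number[OF T] by linarith
qed

section \<open>Attaching paths of odd order\<close>

text \<open>Repeated use of \<open>O2\<close> prolongs a path beyond a vertex of status \<open>B\<close> by any even number of
  vertices. The other \<open>B\<close>-vertices keep their status, so that a path can be prolonged at both ends.\<close>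

lemma labeled_family_prolong:
  assumes "((V, E), (SA, SB, SC)) \<in> labeled_family" "v \<in> SB"
    "even (length ys)" "distinct ys" "set ys \<inter> V = {}"
  shows "\<exists>SB' SC'. ((V \<union> set ys, E \<union> path_edges (v # ys)), (SA \<union> even_positions (v # ys), SB', SC'))
    \<in> labeled_family \<and> SB - {v} \<subseteq> SB'"
  using assms
proof (induction ys arbitrary: V E SA SB SC v rule: even_positions.induct)
  case (1 x y zs)
  let ?SB = "(SB - {v}) \<union> {y}"
  have step: "((V \<union> {x, y}, E \<union> {{v, x}, {x, y}}), (SA \<union> {x}, ?SB, SC \<union> {v})) \<in> labeled_family"
    using 1(2-) by (intro labeled_family.O2) auto
  obtain SB' SC' where res: "((V \<union> {x, y} \<union> set zs, E \<union> {{v, x}, {x, y}} \<union> path_edges (y # zs)),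
      (SA \<union> {x} \<union> even_positions (y # zs), SB', SC')) \<in> labeled_family" "?SB - {y} \<subseteq> SB'"
    proof -
    have "y \<in> ?SB" by simp
    from 1(1)[OF step this] show ?thesis using that 1(4-) by auto
  qed
  have "V \<union> {x, y} \<union> set zs = V \<union> set (x # y # zs)"
    "E \<union> {{v, x}, {x, y}} \<union> path_edges (y # zs) = E \<union> path_edges (v # x # y # zs)"
    "SA \<union> {x} \<union> even_positions (y # zs) = SA \<union> even_positions (v # x # y # zs)" by auto
  moreover have "y \<notin> SB" using labeled_family_labeling_sets[OF 1(2)] 1(6) by auto
  ultimately show ?case using res by (intro exI[of _ SB'] exI[of _ SC']) auto
qed auto

lemma labeled_family_prolong_both:
  assumes fam: "((V, E), (SA, SB, SC)) \<in> labeled_family" and ends: "p \<in> SB" "q \<in> SB" "p \<noteq> q"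
    and "even (length as)" "even (length bs)" "distinct (as @ bs)" "set (as @ bs) \<inter> V = {}"
  shows "\<exists>SB' SC'. ((V \<union> set (as @ bs), E \<union> path_edges (as @ [p]) \<union> path_edges (q # bs)),
    (SA \<union> even_positions (as @ [p]) \<union> even_positions (q # bs), SB', SC')) \<in> labeled_family"
proof -
  obtain SB1 SC1 where 1: "((V \<union> set bs, E \<union> path_edges (q # bs)),
      (SA \<union> even_positions (q # bs), SB1, SC1)) \<in> labeled_family" "SB - {q} \<subseteq> SB1"
    using labeled_family_prolong[OF fam ends(2), of bs] assms by auto
  obtain SB2 SC2 where 2: "((V \<union> set bs \<union> set (rev as), E \<union> path_edges (q # bs) \<union> path_edges (p # rev as)),
      (SA \<union> even_positions (q # bs) \<union> even_positions (p # rev as), SB2, SC2)) \<in> labeled_family"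
    using labeled_family_prolong[OF 1(1), of p "rev as"] 1(2) assms by fastforce
  have "path_edges (p # rev as) = path_edges (as @ [p])" using path_edges_rev[of "as @ [p]"] by simp
  moreover have "even_positions (p # rev as) = even_positions (as @ [p])"
    using even_positions_rev[of "as @ [p]"] assms(5) by simp
  moreover have "V \<union> set bs \<union> set (rev as) = V \<union> set (as @ bs)" by auto
  ultimately show ?thesis using 2 by (intro exI[of _ SB2] exI[of _ SC2]) (simp add: Un_ac)
qed

lemma labeled_family_path:
  assumes "distinct xs" "odd (length xs)" "length xs \<ge> 3"
  shows "\<exists>SB SC. ((set xs, path_edges xs), (even_positions xs, SB, SC)) \<in> labeled_family"
proof -
  obtain u v w zs where xs: "xs = u # v # w # zs"
    using assms(3) by (metis Suc_le_length_iff numeral_3_eq_3)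
  have "(path_graph [u, v, w], ({v}, {u, w}, {})) \<in> labeled_family"
    using assms xs by (intro labeled_family.P3) auto
  then have "(({u, v, w}, {{u, v}, {v, w}}), ({v}, {u, w}, {})) \<in> labeled_family"
    by (simp add: path_graph_eq)
  from labeled_family_prolong[OF this, of w zs] assms xs
  obtain SB SC where "(({u, v, w} \<union> set zs, {{u, v}, {v, w}} \<union> path_edges (w # zs)),
    ({v} \<union> even_positions (w # zs), SB, SC)) \<in> labeled_family" by auto
  moreover have "{u, v, w} \<union> set zs = set xs" "{{u, v}, {v, w}} \<union> path_edges (w # zs) = path_edges xs"
    "{v} \<union> even_positions (w # zs) = even_positions xs" using xs by auto
  ultimately show ?thesis by metis
qed

lemma labeled_family_attach_path_at_end:
  assumes fam: "((V, E), (SA, SB, SC)) \<in> labeled_family" and x: "x \<in> SA"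
    and xs: "distinct (y # ys)" "even (length ys)" "set (y # ys) \<inter> V = {}"
  shows "\<exists>SB' SC'. ((V \<union> set (y # ys), E \<union> {{x, y}} \<union> path_edges (y # ys)),
    (SA \<union> even_positions (y # ys), SB', SC')) \<in> labeled_family"
proof -
  have "((V \<union> {y}, E \<union> {{x, y}}), (SA, SB \<union> {y}, SC)) \<in> labeled_family"
    using fam x xs by (intro labeled_family.O1) auto
  from labeled_family_prolong[OF this, of y ys] xs
  obtain SB' SC' where "((V \<union> {y} \<union> set ys, E \<union> {{x, y}} \<union> path_edges (y # ys)),
    (SA \<union> even_positions (y # ys), SB', SC')) \<in> labeled_family" by auto
  moreover have "V \<union> {y} \<union> set ys = V \<union> set (y # ys)" by auto
  ultimately show ?thesis by metis
qed

text \<open>A new path of odd order may be joined to a labeled tree by any edge that meets the union of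
  \<open>S\<^sub>A\<close> and the even positions of the path. The operations \<open>O1\<close>, \<open>O3\<close> and \<open>O4\<close> create just the part
  of the path around its attachment vertex \<open>y\<close>, according as \<open>y\<close> is an end, at an even position, or
  at an inner odd position; the rest grows by prolonging. Only the class \<open>S\<^sub>A\<close> of the result matters
  for further attachments.\<close>

lemma labeled_family_attach_path:
  assumes fam: "((V, E), (SA, SB, SC)) \<in> labeled_family" and x: "x \<in> V" and y: "y \<in> set xs"
    and xs: "distinct xs" "odd (length xs)" "set xs \<inter> V = {}"
    and cov: "x \<in> SA \<or> y \<in> even_positions xs"
  shows "\<exists>SB' SC'. ((V \<union> set xs, E \<union> {{x, y}} \<union> path_edges xs), (SA \<union> even_positions xs, SB', SC'))
    \<in> labeled_family"
proof (cases "y \<in> even_positions xs")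
  case True
  then obtain as p cs where split: "xs = as @ p # y # cs" "even (length as)"
    using split_at_even_position by metis
  then have "odd (length cs)" using xs by simp
  then obtain q bs where cs: "cs = q # bs" "even (length bs)" by (cases cs) auto
  have xs_eq: "xs = as @ p # y # q # bs" using split cs by simp
  let ?SB = "(SB - {x}) \<union> {p, q}"
  have "((V \<union> {p, y, q}, E \<union> {{x, y}, {p, y}, {y, q}}),
      (SA \<union> {y}, ?SB, if x \<in> SB then SC \<union> {x} else SC)) \<in> labeled_family"
    using fam x xs xs_eq by (intro labeled_family.O3) auto
  from labeled_family_prolong_both[OF this, of p q as bs] xs xs_eq split cs
  obtain SB' SC' where res: "((V \<union> {p, y, q} \<union> set (as @ bs),
      E \<union> {{x, y}, {p, y}, {y, q}} \<union> path_edges (as @ [p]) \<union> path_edges (q # bs)),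
      (SA \<union> {y} \<union> even_positions (as @ [p]) \<union> even_positions (q # bs), SB', SC')) \<in> labeled_family"
    by auto
  have "V \<union> {p, y, q} \<union> set (as @ bs) = V \<union> set xs" using xs_eq by auto
  moreover have "E \<union> {{x, y}, {p, y}, {y, q}} \<union> path_edges (as @ [p]) \<union> path_edges (q # bs) =
      E \<union> {{x, y}} \<union> path_edges xs"
    using xs_eq path_edges_append[of as p "y # q # bs"] by auto
  moreover have "SA \<union> {y} \<union> even_positions (as @ [p]) \<union> even_positions (q # bs) =
      SA \<union> even_positions xs"
    using xs_eq split(2) by (auto simp: even_positions_append)
  ultimately show ?thesis using res by metis
next
  case False
  then have x: "x \<in> SA" using cov by blast
  obtain as bs where split: "xs = as @ y # bs" "even (length as)"
    using split_at_odd_position y False by metis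
  then have even: "even (length bs)" using xs by simp
  consider "as = []" | "bs = []" | "as \<noteq> []" "bs \<noteq> []" by blast
  then show ?thesis
  proof cases
    case 1
    then show ?thesis using labeled_family_attach_path_at_end[OF fam x, of y bs] xs split even by simp
  next
    case 2
    then have rev: "y # rev as = rev xs" using split by simp
    obtain SB' SC' where "((V \<union> set (rev xs), E \<union> {{x, y}} \<union> path_edges (rev xs)),
        (SA \<union> even_positions (rev xs), SB', SC')) \<in> labeled_family"
      using labeled_family_attach_path_at_end[OF fam x, of y "rev as"] xs split(2) unfolding rev by auto
    then show ?thesis using xs(2) by (auto simp: path_edges_rev even_positions_rev)
  next
    case 3
    obtain as' a1 a2 where as: "as = as' @ [a1, a2]" "even (length as')"
    proof -
      obtain cs a2 where cs: "as = cs @ [a2]" using 3(1) by (metis rev_exhaust)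
      then have "cs \<noteq> []" using split(2) by auto
      then obtain ds a1 where "cs = ds @ [a1]" by (metis rev_exhaust)
      then show ?thesis using that cs split(2) by simp
    qed
    obtain b1 b2 bs' where bs: "bs = b1 # b2 # bs'" "even (length bs')"
    proof -
      obtain b1 cs where cs: "bs = b1 # cs" using 3(2) by (metis list.exhaust)
      then have "cs \<noteq> []" using even by auto
      then obtain b2 ds where "cs = b2 # ds" by (metis list.exhaust)
      then show ?thesis using that cs even by simp
    qed
    have xs_eq: "xs = as' @ a1 # a2 # y # b1 # b2 # bs'" using split as bs by simp
    have "((V \<union> {a1, a2, y, b1, b2}, E \<union> {{x, y}, {a1, a2}, {a2, y}, {y, b1}, {b1, b2}}),
        (SA \<union> {a2, b1}, SB \<union> {a1, b2}, SC \<union> {y})) \<in> labeled_family"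
      using fam x xs xs_eq by (intro labeled_family.O4) auto
    from labeled_family_prolong_both[OF this, of a1 b2 as' bs'] xs xs_eq as(2) bs(2)
    obtain SB' SC' where res: "((V \<union> {a1, a2, y, b1, b2} \<union> set (as' @ bs'),
        E \<union> {{x, y}, {a1, a2}, {a2, y}, {y, b1}, {b1, b2}} \<union> path_edges (as' @ [a1]) \<union>
          path_edges (b2 # bs')),
        (SA \<union> {a2, b1} \<union> even_positions (as' @ [a1]) \<union> even_positions (b2 # bs'), SB', SC'))
        \<in> labeled_family"
      by auto
    have "V \<union> {a1, a2, y, b1, b2} \<union> set (as' @ bs') = V \<union> set xs" using xs_eq by auto
    moreover have "E \<union> {{x, y}, {a1, a2}, {a2, y}, {y, b1}, {b1, b2}} \<union> path_edges (as' @ [a1]) \<union>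
        path_edges (b2 # bs') = E \<union> {{x, y}} \<union> path_edges xs"
      using xs_eq path_edges_append[of as' a1 "a2 # y # b1 # b2 # bs'"] by auto
    moreover have "SA \<union> {a2, b1} \<union> even_positions (as' @ [a1]) \<union> even_positions (b2 # bs') =
        SA \<union> even_positions xs"
      using xs_eq as(2) by (auto simp: even_positions_append)
    ultimately show ?thesis using res by metis
  qed
qed

section \<open>Equality forces a spanning tree of the family\<close>

text \<open>Equality leaves no slack in the matching of alternate edges: every path of a minimum cover
  has odd order. If an edge joined odd positions of two of the paths, then matching both paths
  up to these two vertices and adding the edge would give a larger matching.\<close>

lemma equality_path_cover_structure:
  assumes G: "simple_graph G" and eq: "2 * matching_number G + card \<P> = order G"
    and cov: "path_cover G \<P>"
    and r: "\<And>P. P \<in> \<P> \<Longrightarrow> r P \<noteq> [] \<and> distinct (r P) \<and> P = path_graph (r P)"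
  shows "\<And>P. P \<in> \<P> \<Longrightarrow> odd (length (r P))"
    and "\<And>P Q x y. \<lbrakk>P \<in> \<P>; Q \<in> \<P>; P \<noteq> Q; x \<in> verts P; y \<in> verts Q; {x, y} \<in> edges G\<rbrakk> \<Longrightarrow>
      x \<in> even_positions (r P) \<or> y \<in> even_positions (r Q)"
proof -
  have fin: "finite \<P>" by (rule finite_path_cover[OF G cov])
  have vr: "verts P = set (r P)" "edges P = path_edges (r P)" if "P \<in> \<P>" for P
    using r[OF that] by (metis path_graph_eq fst_conv snd_conv)+
  have len: "(\<Sum>P\<in>\<P>. length (r P)) = order G"
    unfolding path_cover_sum_card[OF G cov, symmetric]
    using r vr by (intro sum.cong) (auto simp: distinct_card)
  have matching: "(\<Sum>P\<in>\<P>. length (r P) div 2) \<le> matching_number G"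
  proof -
    have m: "alternate_edges (r P) \<subseteq> edges P \<and> pairwise disjnt (alternate_edges (r P)) \<and>
        card (alternate_edges (r P)) = length (r P) div 2" if "P \<in> \<P>" for P
      using alternate_edges_matching[of "r P"] alternate_edges_subset[of "r P"] r[OF that] vr[OF that]
      by auto
    then have "(\<Sum>P\<in>\<P>. length (r P) div 2) = (\<Sum>P\<in>\<P>. card (alternate_edges (r P)))"
      by (intro sum.cong) auto
    also have "\<dots> \<le> matching_number G"
      using path_cover_union_matching[OF G cov, of "\<lambda>P. alternate_edges (r P)"] m
        card_matching_le[OF G] by metis
    finally show ?thesis .
  qed
  have split: "order G = 2 * (\<Sum>P\<in>\<P>. length (r P) div 2) + (\<Sum>P\<in>\<P>. length (r P) mod 2)"
    unfolding len[symmetric] sum_distrib_left sum.distrib[symmetric] by (intro sum.cong) auto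
  have mod_le: "(\<Sum>P\<in>\<P>. length (r P) mod 2) \<le> (\<Sum>P\<in>\<P>. 1)" by (intro sum_mono) auto
  have mod_eq: "(\<Sum>P\<in>\<P>. length (r P) mod 2) = (\<Sum>P\<in>\<P>. 1)"
  proof -
    have "(\<Sum>P\<in>\<P>. 1) = card \<P>" by simp
    then show ?thesis using split mod_le matching eq by linarith
  qed
  have half: "(\<Sum>P\<in>\<P>. length (r P) div 2) = matching_number G"
    using split mod_eq eq by simp
  show odd: "odd (length (r P))" if "P \<in> \<P>" for P
    using sum_mono_inv[OF mod_eq _ that fin] by (simp add: odd_iff_mod_2_eq_one)
  show "x \<in> even_positions (r P) \<or> y \<in> even_positions (r Q)"
    if PQ: "P \<in> \<P>" "Q \<in> \<P>" "P \<noteq> Q" and xy: "x \<in> verts P" "y \<in> verts Q" "{x, y} \<in> edges G"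
    for P Q x y
  proof (rule ccontr)
    assume neg: "\<not> ?thesis"
    have disj: "v \<notin> verts R'" if "R \<in> \<P>" "R' \<in> \<P>" "R \<noteq> R'" "v \<in> verts R" for v R R'
      using cov that unfolding path_cover_iff by (meson disjnt_iff pairwiseD)
    have "\<exists>M. M \<subseteq> path_edges (r R) \<and> pairwise disjnt M \<and> card M = length (r R) div 2 \<and>
        x \<notin> \<Union> M \<and> y \<notin> \<Union> M" if R: "R \<in> \<P>" for R
    proof -
      note M = near_perfect_matching_avoiding_odd_position[OF _ odd[OF R]]
      consider "R = P" | "R = Q" | "R \<noteq> P" "R \<noteq> Q" by blast
      then show ?thesis
      proof cases
        case 1
        then obtain M where "M \<subseteq> path_edges (r P)" "pairwise disjnt M"
          "card M = length (r P) div 2" "x \<notin> \<Union> M"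
          using M[of x] r[OF PQ(1)] vr[OF PQ(1)] xy(1) neg by auto
        moreover from this have "y \<notin> \<Union> M"
          using path_edges_subset[of _ "r P"] disj[OF PQ(2,1) _ xy(2)] PQ(3) vr[OF PQ(1)] by blast
        ultimately show ?thesis using 1 by blast
      next
        case 2
        then obtain M where "M \<subseteq> path_edges (r Q)" "pairwise disjnt M"
          "card M = length (r Q) div 2" "y \<notin> \<Union> M"
          using M[of y] r[OF PQ(2)] vr[OF PQ(2)] xy(2) neg by auto
        moreover from this have "x \<notin> \<Union> M"
          using path_edges_subset[of _ "r Q"] disj[OF PQ(1,2) _ xy(1)] PQ(3) vr[OF PQ(2)] by blast
        ultimately show ?thesis using 2 by blast
      next
        case 3
        then have "x \<notin> set (r R)" "y \<notin> set (r R)"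
          using disj[OF PQ(1) R _ xy(1)] disj[OF PQ(2) R _ xy(2)] vr[OF R] by auto
        then show ?thesis
          using alternate_edges_matching[of "r R"] alternate_edges_subset[of "r R"] r[OF R]
          by (intro exI[of _ "alternate_edges (r R)"]) blast
      qed
    qed
    then obtain m where m: "\<And>R. R \<in> \<P> \<Longrightarrow> m R \<subseteq> path_edges (r R) \<and> pairwise disjnt (m R) \<and>
        card (m R) = length (r R) div 2 \<and> x \<notin> \<Union> (m R) \<and> y \<notin> \<Union> (m R)" by metis
    let ?M = "\<Union>R\<in>\<P>. m R"
    have M: "matching G ?M" "card ?M = matching_number G"
    proof -
      have *: "m R \<subseteq> edges R \<and> pairwise disjnt (m R)" if "R \<in> \<P>" for R
        using m[OF that] vr[OF that] by simp
      show "matching G ?M" by (rule path_cover_union_matching(1)[OF G cov *])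
      have "card ?M = (\<Sum>R\<in>\<P>. card (m R))" by (rule path_cover_union_matching(2)[OF G cov *])
      also have "\<dots> = matching_number G" using m half by simp
      finally show "card ?M = matching_number G" .
    qed
    have free: "x \<notin> \<Union> ?M" "y \<notin> \<Union> ?M" using m by blast+
    then have "{x, y} \<notin> ?M" by blast
    moreover have "finite ?M"
      using M(1) finite_edges[OF G] by (auto simp: matching_def intro: finite_subset)
    moreover have "matching G (insert {x, y} ?M)"
    proof -
      have "disjnt {x, y} e" if "e \<in> ?M" for e using free that by (auto simp: disjnt_iff)
      then show ?thesis using M(1) xy(3) by (auto simp: matching_def pairwise_insert disjnt_sym)
    qed
    ultimately show False using card_matching_le[OF G, of "insert {x, y} ?M"] M(2) by simp
  qed
qed

lemma connected_graph_crossing_edge: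
  assumes "connected_graph G" "W \<subseteq> verts G" "W \<noteq> {}" "W \<noteq> verts G"
  shows "\<exists>x y. x \<in> W \<and> y \<in> verts G - W \<and> {x, y} \<in> edges G"
proof -
  obtain u v where uv: "u \<in> W" "v \<in> verts G - W" using assms(2-4) by blast
  then have "\<exists>xs. xs \<noteq> [] \<and> distinct xs \<and> hd xs = u \<and> last xs = v \<and> subgraph (path_graph xs) G"
    using assms(1,2) unfolding connected_graph_def by blast
  then obtain xs where xs: "xs \<noteq> []" "distinct xs" "hd xs = u" "last xs = v"
    "subgraph (path_graph xs) G" by (elim exE conjE)
  have "\<exists>x y. x \<in> W \<and> y \<in> set zs - W \<and> {x, y} \<in> path_edges zs"
    if "zs \<noteq> []" "hd zs \<in> W" "last zs \<notin> W" for zs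
    using that
  proof (induction zs rule: path_edges.induct)
    case (1 a b zs)
    then show ?case by (cases "b \<in> W") auto
  qed auto
  from this[of xs] xs uv subgraph_path_graph[OF xs(2), of G] show ?thesis by blast
qed

lemma path_covering_number_le_of_contained_paths:
  assumes "simple_graph T" "verts T = verts G" "path_cover G \<P>" "\<And>P. P \<in> \<P> \<Longrightarrow> edges P \<subseteq> edges T"
  shows "path_covering_number T \<le> card \<P>"
  using assms by (intro path_covering_number_le) (auto simp: path_cover_def subgraph_def)

text \<open>A maximal union of paths of the cover that is spanned by a labeled tree whose \<open>A\<close>-vertices
  are the even positions is all of \<open>G\<close>: otherwise connectedness provides an edge leaving it, and
  the path at the other end of this edge can be attached. Since the tree contains the paths of the
  cover, its path covering number is not larger than that of \<open>G\<close>.\<close>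

lemma equality_spanning_tree:
  assumes G: "simple_graph G" and conn: "connected_graph G" and n: "order G \<ge> 3"
    and eq: "2 * matching_number G + path_covering_number G = order G"
  shows "\<exists>T SA SB SC. (T, SA, SB, SC) \<in> labeled_family \<and> verts T = verts G \<and> edges T \<subseteq> edges G \<and>
    path_covering_number T \<le> path_covering_number G"
proof -
  obtain \<P> where cov: "path_cover G \<P>" and card: "card \<P> = path_covering_number G"
    using obtain_minimum_path_cover[OF G] by blast
  obtain r where r: "\<And>P. P \<in> \<P> \<Longrightarrow> r P \<noteq> [] \<and> distinct (r P) \<and> P = path_graph (r P)"
    using obtain_traversals[OF cov] by blast
  have eq': "2 * matching_number G + card \<P> = order G" using eq card by simp
  have odd: "odd (length (r P))" if "P \<in> \<P>" for P
    using equality_path_cover_structure(1)[OF G eq' cov, of r] r that by metis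
  have crossing: "x \<in> even_positions (r P) \<or> y \<in> even_positions (r Q)"
    if "P \<in> \<P>" "Q \<in> \<P>" "P \<noteq> Q" "x \<in> verts P" "y \<in> verts Q" "{x, y} \<in> edges G" for P Q x y
    using equality_path_cover_structure(2)[OF G eq' cov, of r] r that by metis
  have fin: "finite \<P>" by (rule finite_path_cover[OF G cov])
  have vr: "verts P = set (r P)" "edges P = path_edges (r P)" if "P \<in> \<P>" for P
    using r[OF that] by (metis path_graph_eq fst_conv snd_conv)+
  have in_path: "\<exists>P\<in>\<P>. v \<in> verts P" if "v \<in> verts G" for v
    using cov that unfolding path_cover_iff by blast
  have sub: "verts P \<subseteq> verts G" "edges P \<subseteq> edges G" if "P \<in> \<P>" for P
    using cov that by (auto simp: path_cover_def subgraph_def)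
  \<comment> \<open>The condition that \<open>E\<close> contains the paths is what will keep the path covering number down.\<close>
  define good where "good U \<longleftrightarrow> U \<subseteq> \<P> \<and> U \<noteq> {} \<and> (\<exists>E SB SC.
    ((\<Union>P\<in>U. verts P, E), (\<Union>P\<in>U. even_positions (r P), SB, SC)) \<in> labeled_family \<and>
    (\<Union>P\<in>U. edges P) \<subseteq> E \<and> E \<subseteq> edges G)" for U
  \<comment> \<open>A path with three vertices is needed to start from: if all paths were single vertices, there
    would be no even positions for the edges of \<open>G\<close> to meet.\<close>
  have "\<exists>P\<in>\<P>. length (r P) \<ge> 3"
  proof -
    obtain v where v: "v \<in> verts G" using conn unfolding connected_graph_def by blast
    have "{v} \<noteq> verts G"
    proof
      assume "{v} = verts G"
      then have "card (verts G) = 1" by (metis is_singletonI is_singleton_altdef)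
      then show False using n by (simp add: order_def)
    qed
    then obtain x y where xy: "x \<in> verts G" "y \<in> verts G" "x \<noteq> y" "{x, y} \<in> edges G"
      using connected_graph_crossing_edge[OF conn, of "{v}"] v by auto
    obtain P Q where PQ: "P \<in> \<P>" "x \<in> verts P" "Q \<in> \<P>" "y \<in> verts Q" using in_path xy by meson
    have big: "length zs \<ge> 3" if "odd (length zs)" "length zs \<noteq> 1" for zs :: "'a list"
      using that by (cases "length zs = 2") (auto, presburger)
    show ?thesis
    proof (cases "P = Q")
      case True
      have "length (r P) \<noteq> 1"
      proof
        assume "length (r P) = 1"
        then obtain z where "r P = [z]" by (auto simp: length_Suc_conv)
        then show False using PQ True vr[OF PQ(1)] xy(3) by simp
      qed
      then show ?thesis using big odd PQ by blast
    next
      case False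
      then have "\<exists>R\<in>\<P>. even_positions (r R) \<noteq> {}" using crossing[OF PQ(1,3) _ PQ(2,4) xy(4)] PQ by blast
      then obtain R where R: "R \<in> \<P>" "even_positions (r R) \<noteq> {}" by blast
      then have "length (r R) \<noteq> 1" by (auto simp: length_Suc_conv)
      then show ?thesis using big odd R by blast
    qed
  qed
  then obtain P0 where P0: "P0 \<in> \<P>" "length (r P0) \<ge> 3" by blast
  obtain SB SC where "((set (r P0), path_edges (r P0)), (even_positions (r P0), SB, SC)) \<in> labeled_family"
    using labeled_family_path[of "r P0"] r odd P0 by blast
  then have "good {P0}" using P0 vr[OF P0(1)] sub[OF P0(1)] by (auto simp: good_def)
  moreover have "\<And>U. good U \<Longrightarrow> card U < Suc (card \<P>)"
    using card_mono[OF fin] by (simp add: good_def less_Suc_eq_le)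
  ultimately obtain U where U: "good U" and max: "\<And>U'. good U' \<Longrightarrow> card U' \<le> card U"
    using ex_has_greatest_nat[of good "{P0}" card "Suc (card \<P>)"] by (metis less_imp_le)
  obtain E SB SC where fam: "((\<Union>P\<in>U. verts P, E), (\<Union>P\<in>U. even_positions (r P), SB, SC))
      \<in> labeled_family" and E: "(\<Union>P\<in>U. edges P) \<subseteq> E" "E \<subseteq> edges G"
    and U_sub: "U \<subseteq> \<P>" "U \<noteq> {}" using U by (auto simp: good_def)
  let ?W = "\<Union>P\<in>U. verts P"
  have "?W = verts G"
  proof (rule ccontr)
    assume neq: "?W \<noteq> verts G"
    have "?W \<subseteq> verts G" using sub U_sub by blast
    moreover have "?W \<noteq> {}" using U_sub r vr by (metis SUP_bot_conv(1) equals0I set_empty subsetD)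
    ultimately obtain x y where xy: "x \<in> ?W" "y \<in> verts G - ?W" "{x, y} \<in> edges G"
      using connected_graph_crossing_edge[OF conn] neq by meson
    obtain Q where Q: "Q \<in> \<P>" "y \<in> verts Q" using in_path xy(2) by blast
    obtain P where P: "P \<in> U" "x \<in> verts P" using xy(1) by blast
    have "Q \<notin> U" using Q(2) xy(2) by blast
    then have "P \<noteq> Q" "P \<in> \<P>" using P U_sub by auto
    then have "x \<in> even_positions (r P) \<or> y \<in> even_positions (r Q)"
      using crossing[OF _ Q(1) _ P(2) Q(2) xy(3)] by blast
    then have cover: "x \<in> (\<Union>P\<in>U. even_positions (r P)) \<or> y \<in> even_positions (r Q)" using P(1) by blast
    have fresh: "set (r Q) \<inter> ?W = {}"
    proof -
      have "disjnt (verts Q) (verts R)" if "R \<in> U" for R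
        using cov Q(1) that U_sub \<open>Q \<notin> U\<close> unfolding path_cover_iff by (metis pairwiseD subsetD)
      then show ?thesis using vr[OF Q(1)] unfolding disjnt_def by blast
    qed
    have "y \<in> set (r Q)" using Q vr by simp
    from labeled_family_attach_path[OF fam xy(1) this _ odd[OF Q(1)] fresh cover] r[OF Q(1)]
    obtain SB' SC' where new: "((?W \<union> set (r Q), E \<union> {{x, y}} \<union> path_edges (r Q)),
        ((\<Union>P\<in>U. even_positions (r P)) \<union> even_positions (r Q), SB', SC')) \<in> labeled_family" by blast
    have "good (insert Q U)"
      unfolding good_def
    proof (intro conjI exI)
      show "((\<Union>P\<in>insert Q U. verts P, E \<union> {{x, y}} \<union> path_edges (r Q)),
          (\<Union>P\<in>insert Q U. even_positions (r P), SB', SC')) \<in> labeled_family"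
        using new vr(1)[OF Q(1)] by (simp add: Un_commute)
      show "(\<Union>P\<in>insert Q U. edges P) \<subseteq> E \<union> {{x, y}} \<union> path_edges (r Q)"
        using E(1) vr(2)[OF Q(1)] by auto
      show "E \<union> {{x, y}} \<union> path_edges (r Q) \<subseteq> edges G"
        using E(2) xy(3) vr(2)[OF Q(1)] sub(2)[OF Q(1)] by auto
    qed (use U_sub Q in auto)
    then have "card (insert Q U) \<le> card U" by (rule max)
    then show False using \<open>Q \<notin> U\<close> finite_subset[OF U_sub(1) fin] by simp
  qed
  moreover have "U = \<P>"
  proof (rule ccontr)
    assume "U \<noteq> \<P>"
    then obtain Q where Q: "Q \<in> \<P>" "Q \<notin> U" using U_sub by blast
    have "hd (r Q) \<in> verts Q" using r vr Q by simp
    then obtain R where R: "R \<in> U" "hd (r Q) \<in> verts R"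
      using \<open>?W = verts G\<close> sub(1)[OF Q(1)] by blast
    then have "disjnt (verts Q) (verts R)"
      using cov Q U_sub unfolding path_cover_iff by (metis pairwiseD subsetD)
    then show False using R \<open>hd (r Q) \<in> verts Q\<close> by (auto simp: disjnt_iff)
  qed
  moreover have "simple_graph (?W, E)"
    using labeled_family_tree[OF fam] by (simp add: tree_def)
  ultimately have "path_covering_number (?W, E) \<le> card \<P>"
    using E(1) cov by (intro path_covering_number_le_of_contained_paths[of _ G]) auto
  then show ?thesis using fam \<open>?W = verts G\<close> E(2) card
    by (intro exI[of _ "(?W, E)"]) auto
qed

theorem theorem7:
  fixes G :: "'a ugraph"
  assumes "simple_graph G"
  shows "real (matching_number G) + 1 / 2 * real (path_covering_number G) \<ge> real (order G) / 2 \<and>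
    (order G \<ge> 3 \<longrightarrow> connected_graph G \<longrightarrow>
      (real (matching_number G) + 1 / 2 * real (path_covering_number G) = real (order G) / 2 \<longleftrightarrow>
       (\<exists>T. spanning_tree T G \<and>
            (\<exists>S. labeling_of T S \<and> (T, S) \<in> labeled_family) \<and>
            matching_number G = matching_number T \<and>
            path_covering_number G = path_covering_number T)))"
proof (intro conjI impI)
  have eq_iff: "real (matching_number G) + 1 / 2 * real (path_covering_number G) = real (order G) / 2 \<longleftrightarrow>
      2 * matching_number G + path_covering_number G = order G" by linarith
  show "real (matching_number G) + 1 / 2 * real (path_covering_number G) \<ge> real (order G) / 2"
    using order_le_matching_path_covering_number[OF assms] by linarith
  assume n: "order G \<ge> 3" and conn: "connected_graph G"
  show "real (matching_number G) + 1 / 2 * real (path_covering_number G) = real (order G) / 2 \<longleftrightarrow>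
       (\<exists>T. spanning_tree T G \<and>
            (\<exists>S. labeling_of T S \<and> (T, S) \<in> labeled_family) \<and>
            matching_number G = matching_number T \<and>
            path_covering_number G = path_covering_number T)" (is "?eq \<longleftrightarrow> ?tree")
  proof
    assume ?eq
    then have eq: "2 * matching_number G + path_covering_number G = order G" using eq_iff by simp
    obtain T SA SB SC where fam: "(T, SA, SB, SC) \<in> labeled_family"
      and T: "verts T = verts G" "edges T \<subseteq> edges G" "path_covering_number T \<le> path_covering_number G"
      using equality_spanning_tree[OF assms conn n eq] by (elim exE conjE)
    have tree: "tree T" by (rule labeled_family_tree[OF fam])
    then have sub: "subgraph T G" using T by (simp add: subgraph_def tree_def)
    have pc: "path_covering_number G = path_covering_number T"
      using path_covering_number_spanning_subgraph[OF assms sub T(1)] T(3) by simp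
    moreover have "order T = order G" using T(1) by (simp add: order_def)
    then have "matching_number G = matching_number T"
      using labeled_family_equality[OF fam] eq pc by simp
    moreover have "spanning_tree T G" using tree sub T(1) by (simp add: spanning_tree_def)
    ultimately show ?tree using fam labeled_family_labeling[OF fam] by blast
  next
    assume ?tree
    then obtain T S where T: "spanning_tree T G" "(T, S) \<in> labeled_family"
      "matching_number G = matching_number T" "path_covering_number G = path_covering_number T"
      by (elim exE conjE)
    moreover obtain SA SB SC where "S = (SA, SB, SC)" by (cases S)
    ultimately have "2 * matching_number T + path_covering_number T = order T"
      using labeled_family_equality by metis
    moreover have "order T = order G" using T(1) by (simp add: order_def spanning_tree_def)
    ultimately show ?eq using T eq_iff by simp
  qed
qed

end
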